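(* Let $n\ge 1$. A subset $W\subset (\mathbb{R}_{\max}^n)^2$ is the orthogonal of a max-plus convex cone, i.e. $W=V^\bot$ for some max-plus convex cone $V\subset\mathbb{R}_{\max}^n$, if and only if the following conditions are satisfied: (i) $W$ is a closed max-plus convex cone (as a subset of $(\mathbb{R}_{\max}^n)^2\cong\mathbb{R}_{\max}^{2n}$); (ii) $(f,f)\in W$ for all $f\in\mathbb{R}_{\max}^n$; (iii) $(f,g)\in W$ implies $(g,f)\in W$; (iv) $(f,g)\in W$ and $(g,h)\in W$ imply $(f,h)\in W$.
   Context: $\mathbb{R}_{\max}$ is the max-plus semiring: the set $\mathbb{R}\cup\{-\infty\}$ with addition $a\oplus b=\max(a,b)$ and multiplication $a\otimes b=a+b$ (with $-\infty$ absorbing for $\otimes$). The topology on $\mathbb{R}_{\max}$ is given by the metric $d(a,b)=|\exp(a)-\exp(b)|$ (with $\exp(-\infty)=0$), and products carry the product topology. A max-plus convex cone (semimodule) in $\mathbb{R}_{\max}^m$ is a subset $V$ such that $\max(\lambda+x,\mu+y)\in V$ for all $x,y\in V$ and $\lambda,\mu\in\mathbb{R}_{\max}$, where $\lambda+x$ is the vector with entries $\lambda+x_i$ and the max is entrywise. The orthogonal of a max-plus convex cone $V\subset\mathbb{R}_{\max}^n$ is $$V^\bot=\{(f,g)\in(\mathbb{R}_{\max}^n)^2 \mid \max_i(f_i+x_i)=\max_j(g_j+x_j)\ \ \forall x\in V\}.$$ *)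

theory Defs
  imports "HOL-Analysis.Analysis"
begin

text \<open>
  The max-plus semiring: the extended reals without \<open>\<infinity>\<close>. The type class operations are the
  semiring ones: \<open>+\<close> is the maximum, \<open>*\<close> is the addition of (extended) real
  numbers, \<open>0\<close> is \<open>-\<infinity>\<close>, and \<open>1\<close> is the real number zero. The order is the usual one.
\<close>

typedef rmax = "{x :: ereal. x \<noteq> \<infinity>}"
  by (rule exI[of _ 0]) simp

setup_lifting type_definition_rmax

instantiation rmax :: linorder
begin

lift_definition less_eq_rmax :: "rmax \<Rightarrow> rmax \<Rightarrow> bool" is "(\<le>)" .
lift_definition less_rmax :: "rmax \<Rightarrow> rmax \<Rightarrow> bool" is "(<)" .

instance by standard (transfer; auto)+

end

instantiation rmax :: comm_semiring_1
begin

lift_definition zero_rmax :: rmax is "-\<infinity> :: ereal" by simp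
lift_definition one_rmax :: rmax is "0 :: ereal" by simp
lift_definition plus_rmax :: "rmax \<Rightarrow> rmax \<Rightarrow> rmax" is "max :: ereal \<Rightarrow> ereal \<Rightarrow> ereal"
  by (auto simp: max_def)
lift_definition times_rmax :: "rmax \<Rightarrow> rmax \<Rightarrow> rmax" is "(+) :: ereal \<Rightarrow> ereal \<Rightarrow> ereal"
  by simp

instance
proof
  fix a b c :: rmax
  show "a + b + c = a + (b + c)" by transfer (simp add: max.assoc)
  show "a + b = b + a" by transfer (simp add: max.commute)
  show "0 + a = a" by transfer (simp add: max_def)
  show "a * b * c = a * (b * c)" by transfer (simp add: add.assoc)
  show "a * b = b * a" by transfer (simp add: add.commute)
  show "1 * a = a" by transfer simp
  show "0 * a = 0" by transfer simp
  show "a * 0 = 0" by transfer simp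
  show "(a + b) * c = a * c + b * c"
    by transfer (metis add_right_mono linear max.absorb1 max.absorb2)
  show "(0 :: rmax) \<noteq> 1" by transfer simp
qed

end

lemma rmax_plus_eq_max: "a + b = max a b" for a b :: rmax
  unfolding max_def by transfer (simp add: max_def)

lift_definition exp_rmax :: "rmax \<Rightarrow> real"
  is "\<lambda>x. if x = -\<infinity> then 0 else exp (real_of_ereal x)" .

lemma exp_rmax_inject: "exp_rmax a = exp_rmax b \<longleftrightarrow> a = b"
proof (transfer, goal_cases)
  case (1 a b)
  then show ?case by (cases a; cases b) auto
qed

instantiation rmax :: metric_space
begin

definition dist_rmax :: "rmax \<Rightarrow> rmax \<Rightarrow> real" where
  "dist_rmax a b = \<bar>exp_rmax a - exp_rmax b\<bar>"

definition uniformity_rmax :: "(rmax \<times> rmax) filter" where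
  "uniformity_rmax = (INF e\<in>{0<..}. principal {(x, y). dist x y < e})"

definition open_rmax :: "rmax set \<Rightarrow> bool" where
  "open_rmax U \<longleftrightarrow> (\<forall>x\<in>U. eventually (\<lambda>(x', y). x' = x \<longrightarrow> y \<in> U) uniformity)"

instance
  by standard (auto simp: dist_rmax_def uniformity_rmax_def open_rmax_def exp_rmax_inject)

end

text \<open>
  The action of the scalars is a parameter, so that the same notion applies to vectors
  (with \<^term>\<open>(*s)\<close>) and to pairs of vectors (with \<open>pair_scale\<close> below).
  Addition on both types is the entrywise maximum.
\<close>

definition maxplus_cone :: "(rmax \<Rightarrow> 'a \<Rightarrow> 'a) \<Rightarrow> 'a::plus set \<Rightarrow> bool" where
  "maxplus_cone smul V \<longleftrightarrow>
     (\<forall>x\<in>V. \<forall>y\<in>V. \<forall>a b. smul a x + smul b y \<in> V)"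

definition pair_scale ::
  "rmax \<Rightarrow> (rmax ^ 'n) \<times> (rmax ^ 'n) \<Rightarrow> (rmax ^ 'n) \<times> (rmax ^ 'n)" where
  "pair_scale a = (\<lambda>(f, g). (a *s f, a *s g))"

definition maxplus_orthogonal :: "(rmax ^ 'n) set \<Rightarrow> ((rmax ^ 'n) \<times> (rmax ^ 'n)) set" where
  "maxplus_orthogonal V =
     {(f, g). \<forall>x\<in>V. (MAX i. f $ i * x $ i) = (MAX j. g $ j * x $ j)}"

end

theory Submission
  imports Defs
begin

text \<open>
  The difficult implication is a separation argument. The relation \<open>W\<close> is a congruence, with
  associated preorder \<open>u \<preceq> v\<close> iff \<open>(u + v, v) \<in> W\<close>. If \<open>(f, g) \<notin> W\<close>, then up to exchanging
  \<open>f\<close> and \<open>g\<close> we have \<open>f \<preceq> g\<close> false, and as \<open>W\<close> is closed this remains so after \<open>g\<close> is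
  replaced by the maximum of \<open>g\<close> and a small constant vector. Now all entries of \<open>g\<close> are nonzero, so
  the gauge \<open>\<phi> h = min {c. h \<preceq> c g}\<close> takes only values in the max-plus semiring, the minimum being
  attained by closedness. The gauge is a linear form \<open>h \<mapsto> max\<^sub>i h\<^sub>i x\<^sub>i\<close> that is monotone for
  \<open>\<preceq>\<close>, so that \<open>x\<close> is in the cone orthogonal to \<open>W\<close>, while \<open>\<phi> g \<le> 1 < \<phi> f\<close>.
\<close>

section \<open>The max-plus semiring\<close>

lemma exp_rmax_zero: "exp_rmax 0 = 0"
  by transfer simp

lemma exp_rmax_nonneg: "0 \<le> exp_rmax a"
  by transfer simp

lemma exp_rmax_le_iff: "exp_rmax a \<le> exp_rmax b \<longleftrightarrow> a \<le> b"
proof (transfer, goal_cases)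
  case (1 a b)
  then show ?case by (cases a; cases b) (auto simp: not_le)
qed

lemma exp_rmax_add: "exp_rmax (a + b) = max (exp_rmax a) (exp_rmax b)"
  by (auto simp: rmax_plus_eq_max max_def exp_rmax_le_iff)

lemma exp_rmax_mult: "exp_rmax (a * b) = exp_rmax a * exp_rmax b"
proof (transfer, goal_cases)
  case (1 a b)
  then show ?case by (cases a; cases b) (auto simp: exp_add)
qed

text \<open>This completes the identification of the semiring with the nonnegative reals under
  maximum and product, from which inverses and infima are imported.\<close>

lemma exp_rmax_surj:
  assumes "0 \<le> r"
  obtains a where "exp_rmax a = r"
proof (cases "r = 0")
  case True
  then show thesis using that exp_rmax_zero by blast
next
  case False
  have "exp_rmax (Abs_rmax (ereal (ln r))) = r"
    using False assms by (simp add: exp_rmax.rep_eq Abs_rmax_inverse)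
  then show thesis by (rule that)
qed

lemma rmax_add_idem: "a + a = a" for a :: rmax
  by (simp add: rmax_plus_eq_max)

lemma vec_add_idem: "v + v = v" for v :: "rmax ^ 'n"
  by (simp add: vec_eq_iff rmax_add_idem)

lemma vec_add_left_idem: "v + (v + w) = v + w" for v w :: "rmax ^ 'n"
  by (simp add: add.assoc[symmetric] vec_add_idem)

lemma rmax_le_iff_add: "a \<le> b \<longleftrightarrow> a + b = b" for a b :: rmax
  by (auto simp: rmax_plus_eq_max max_def)

lemma rmax_zero_le: "0 \<le> a" for a :: rmax
  by (simp add: rmax_le_iff_add)

lemma rmax_mult_left_mono: "a \<le> b \<Longrightarrow> c * a \<le> c * b" for a b c :: rmax
  by (metis rmax_le_iff_add distrib_left)

lemma rmax_inverse:
  fixes a :: rmax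
  assumes "a \<noteq> 0"
  obtains b where "a * b = 1"
proof -
  have "exp_rmax a \<noteq> 0" using assms exp_rmax_inject exp_rmax_zero by metis
  moreover obtain b where "exp_rmax b = inverse (exp_rmax a)"
    using exp_rmax_surj[of "inverse (exp_rmax a)"] exp_rmax_nonneg by auto
  moreover have "exp_rmax 1 = 1" by transfer (simp add: zero_ereal_def)
  ultimately have "exp_rmax (a * b) = exp_rmax 1" by (simp add: exp_rmax_mult)
  then show thesis using that by (simp add: exp_rmax_inject)
qed

lemma rmax_sum_le_iff:
  fixes F :: "'a \<Rightarrow> rmax"
  assumes "finite A"
  shows "sum F A \<le> c \<longleftrightarrow> (\<forall>i\<in>A. F i \<le> c)"
  using assms by (induction A) (auto simp: rmax_zero_le rmax_plus_eq_max)

text \<open>Both sides have the same upper bounds, since addition is the maximum. Linear forms can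
  thus be treated with the algebra of \<open>sum\<close>.\<close>

lemma rmax_Max_eq_sum: "(MAX i. F i) = (\<Sum>i\<in>UNIV. F i)" for F :: "'a::finite \<Rightarrow> rmax"
proof -
  have "(MAX i. F i) \<le> c \<longleftrightarrow> (\<Sum>i\<in>UNIV. F i) \<le> c" for c
    by (simp add: rmax_sum_le_iff)
  then show ?thesis by (metis order_refl antisym)
qed

section \<open>Topology\<close>

text \<open>The metric is pulled back along \<open>exp_rmax\<close>, so continuity of the operations
  reduces to that of maximum and product of reals.\<close>

lemma tendsto_exp_rmax_iff:
  "((\<lambda>x. exp_rmax (F x)) \<longlongrightarrow> exp_rmax l) G \<longleftrightarrow> (F \<longlongrightarrow> l) G"
  by (simp add: tendsto_iff dist_rmax_def dist_real_def)

instance rmax :: topological_comm_monoid_add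
proof
  fix a b :: rmax
  have "((\<lambda>x. exp_rmax (fst x + snd x)) \<longlongrightarrow> exp_rmax (a + b)) (nhds a \<times>\<^sub>F nhds b)"
    unfolding exp_rmax_add
    by (intro tendsto_max tendsto_exp_rmax_iff[THEN iffD2] filterlim_fst filterlim_snd)
  then show "((\<lambda>x. fst x + snd x) \<longlongrightarrow> a + b) (nhds a \<times>\<^sub>F nhds b)"
    by (simp only: tendsto_exp_rmax_iff)
qed

instance rmax :: topological_semigroup_mult
proof
  fix a b :: rmax
  have "((\<lambda>x. exp_rmax (fst x * snd x)) \<longlongrightarrow> exp_rmax (a * b)) (nhds a \<times>\<^sub>F nhds b)"
    unfolding exp_rmax_mult
    by (intro tendsto_mult tendsto_exp_rmax_iff[THEN iffD2] filterlim_fst filterlim_snd)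
  then show "((\<lambda>x. fst x * snd x) \<longlongrightarrow> a * b) (nhds a \<times>\<^sub>F nhds b)"
    by (simp only: tendsto_exp_rmax_iff)
qed

text \<open>The infimum of the exponentials is nonnegative, hence itself an exponential, and its
  preimage lies in the closure of \<open>S\<close>.\<close>

lemma rmax_closed_has_least:
  fixes S :: "rmax set"
  assumes "closed S" "S \<noteq> {}"
  obtains m where "m \<in> S" "\<And>a. a \<in> S \<Longrightarrow> m \<le> a"
proof -
  define r where "r = Inf (exp_rmax ` S)"
  have bdd: "bdd_below (exp_rmax ` S)"
    by (rule bdd_belowI2[of _ 0]) (simp add: exp_rmax_nonneg)
  have r_le: "r \<le> exp_rmax a" if "a \<in> S" for a
    unfolding r_def using bdd that by (intro cInf_lower) auto
  have "0 \<le> r"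
    unfolding r_def using assms(2) by (intro cInf_greatest) (auto simp: exp_rmax_nonneg)
  then obtain m where m: "exp_rmax m = r" by (rule exp_rmax_surj)
  have "m \<in> closure S"
    unfolding closure_approachable
  proof (intro allI impI)
    fix e :: real
    assume "0 < e"
    then have "Inf (exp_rmax ` S) < r + e" by (simp add: r_def)
    then obtain a where "a \<in> S" "exp_rmax a < r + e"
      using assms(2) by (auto dest: cInf_lessD[rotated])
    then show "\<exists>a\<in>S. dist a m < e"
      using r_le[of a] by (intro bexI[of _ a]) (auto simp: dist_rmax_def m)
  qed
  then have "m \<in> S" using assms(1) by simp
  then show thesis using that r_le m exp_rmax_le_iff by metis
qed

text \<open>The point \<open>0\<close> is not isolated; this permits the small perturbation in
  \<open>separation\<close>.\<close>

lemma rmax_nhd_zero_nonzero: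
  fixes U :: "rmax set"
  assumes "open U" "0 \<in> U"
  obtains c where "c \<in> U" "c \<noteq> 0"
proof -
  obtain e where e: "e > 0" "\<And>c. dist c 0 < e \<Longrightarrow> c \<in> U"
    using assms by (meson open_dist)
  obtain c where c: "exp_rmax c = e / 2"
    using e(1) by (auto intro: exp_rmax_surj[of "e / 2"])
  have "c \<in> U" using e c by (intro e(2)) (simp add: dist_rmax_def exp_rmax_zero)
  moreover have "c \<noteq> 0" using c e(1) exp_rmax_zero by auto
  ultimately show thesis by (rule that)
qed

section \<open>Orthogonals\<close>

lemma maxplus_orthogonal_iff:
  "(f, g) \<in> maxplus_orthogonal V \<longleftrightarrow>
    (\<forall>x\<in>V. (\<Sum>i\<in>UNIV. f $ i * x $ i) = (\<Sum>i\<in>UNIV. g $ i * x $ i))"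
  by (simp add: maxplus_orthogonal_def rmax_Max_eq_sum)

lemma rmax_form_linear:
  fixes f g x :: "rmax ^ 'n"
  shows "(\<Sum>i\<in>UNIV. (a *s f + b *s g) $ i * x $ i) =
    a * (\<Sum>i\<in>UNIV. f $ i * x $ i) + b * (\<Sum>i\<in>UNIV. g $ i * x $ i)"
  by (simp add: sum_distrib_left distrib_right sum.distrib mult.assoc)

lemma closed_maxplus_orthogonal: "closed (maxplus_orthogonal V)"
proof -
  have "maxplus_orthogonal V =
    (\<Inter>x\<in>V. {p. (\<Sum>i\<in>UNIV. fst p $ i * x $ i) = (\<Sum>i\<in>UNIV. snd p $ i * x $ i)})"
    by (auto simp: maxplus_orthogonal_iff)
  then show ?thesis
    by (auto intro!: closed_INT closed_Collect_eq continuous_intros)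
qed

lemma maxplus_cone_maxplus_orthogonal: "maxplus_cone pair_scale (maxplus_orthogonal V)"
  unfolding maxplus_cone_def pair_scale_def
  by (auto simp: maxplus_orthogonal_iff rmax_form_linear
      simp del: vector_add_component vector_smult_component)

section \<open>Closed congruences\<close>

locale closed_congruence =
  fixes W :: "((rmax ^ 'n) \<times> (rmax ^ 'n)) set"
  assumes closed: "closed W"
    and cone: "maxplus_cone pair_scale W"
    and refl: "(f, f) \<in> W"
    and sym: "(f, g) \<in> W \<Longrightarrow> (g, f) \<in> W"
    and trans: "(f, g) \<in> W \<Longrightarrow> (g, h) \<in> W \<Longrightarrow> (f, h) \<in> W"
begin

text \<open>Modulo \<open>W\<close> this is the natural order \<open>u + v = v\<close> of an
  idempotent addition.\<close>

definition below :: "rmax ^ 'n \<Rightarrow> rmax ^ 'n \<Rightarrow> bool"  (infix \<open>\<preceq>\<close> 50) where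
  "u \<preceq> v \<longleftrightarrow> (u + v, v) \<in> W"

lemma add: "(f, g) \<in> W \<Longrightarrow> (f', g') \<in> W \<Longrightarrow> (f + f', g + g') \<in> W"
  using cone unfolding maxplus_cone_def pair_scale_def
  by (force dest: spec[of _ 1] simp: vector_smult_lid)

lemma scale: "(f, g) \<in> W \<Longrightarrow> (a *s f, a *s g) \<in> W"
proof -
  assume "(f, g) \<in> W"
  then have "pair_scale a (f, g) + pair_scale 0 (f, g) \<in> W"
    using cone unfolding maxplus_cone_def by blast
  then show ?thesis by (simp add: pair_scale_def)
qed

lemma below_if_le: "(\<And>i. u $ i \<le> v $ i) \<Longrightarrow> u \<preceq> v"
proof -
  assume "\<And>i. u $ i \<le> v $ i"
  then have "u + v = v" by (simp add: vec_eq_iff rmax_le_iff_add)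
  then show ?thesis by (simp add: below_def refl)
qed

lemma below_trans:
  assumes "u \<preceq> v" "v \<preceq> w"
  shows "u \<preceq> w"
proof -
  have "(u + v + w, v + w) \<in> W" using assms(1) refl add unfolding below_def by blast
  then have "(u + v + w, w) \<in> W" using assms(2) trans unfolding below_def by blast
  \<comment> \<open>Adding \<open>u + w\<close> to both sides eliminates \<open>v\<close>: by
    idempotence \<open>u + w\<close> is congruent to \<open>u + v + w\<close>, hence to
    \<open>w\<close>.\<close>
  then have "(w + (u + w), u + v + w + (u + w)) \<in> W" using sym refl add by blast
  moreover have "w + (u + w) = u + w" "u + v + w + (u + w) = u + v + w"
    by (simp_all add: ac_simps vec_add_idem vec_add_left_idem)
  ultimately show ?thesis
    using \<open>(u + v + w, w) \<in> W\<close> trans unfolding below_def by metis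
qed

lemma below_add: "u \<preceq> w \<Longrightarrow> v \<preceq> w \<Longrightarrow> u + v \<preceq> w"
proof -
  assume "u \<preceq> w" "v \<preceq> w"
  then have "(u + w + (v + w), w + w) \<in> W" unfolding below_def by (rule add)
  moreover have "u + w + (v + w) = u + v + w"
    by (simp add: ac_simps vec_add_idem vec_add_left_idem)
  ultimately show ?thesis by (simp add: below_def vec_add_idem)
qed

lemma below_sum: "finite A \<Longrightarrow> (\<And>i. i \<in> A \<Longrightarrow> F i \<preceq> w) \<Longrightarrow> sum F A \<preceq> w"
  by (induction A rule: finite_induct) (auto intro: below_add below_if_le simp: rmax_zero_le)

lemma below_scale: "u \<preceq> v \<Longrightarrow> a *s u \<preceq> a *s v"
  unfolding below_def vector_add_ldistrib[symmetric] by (rule scale)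

lemma below_if_mem: "(u, v) \<in> W \<Longrightarrow> u \<preceq> v"
  using add[of u v v v] refl by (simp add: below_def vec_add_idem)

lemma below_antisym: "u \<preceq> v \<Longrightarrow> v \<preceq> u \<Longrightarrow> (u, v) \<in> W"
  unfolding below_def by (metis add.commute sym trans)

lemma closed_below:
  assumes "continuous_on UNIV F" "continuous_on UNIV G"
  shows "closed {c::rmax. F c \<preceq> G c}"
proof -
  have "continuous_on UNIV (\<lambda>c. F c + G c)"
    unfolding plus_vec_def
    by (intro continuous_on_vec_lambda continuous_intros assms)
  then have "continuous_on UNIV (\<lambda>c. (F c + G c, G c))"
    by (intro continuous_intros assms)
  then have "closed ((\<lambda>c. (F c + G c, G c)) -` W)"
    using closed by (intro closed_vimage)
  then show ?thesis by (simp add: below_def vimage_def)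
qed

text \<open>Take for \<open>x $ i\<close> the least \<open>c\<close> with
  \<open>axis i 1 \<preceq> c *s g\<close>. As \<open>h\<close> is the maximum of the vectors
  \<open>h $ i *s axis i 1\<close>, the relation \<open>h \<preceq> c *s g\<close> can be tested one
  coordinate at a time.\<close>

lemma ex_gauge:
  assumes "\<And>i. g $ i \<noteq> 0"
  obtains x where "\<And>h c. (\<Sum>i\<in>UNIV. h $ i * x $ i) \<le> c \<longleftrightarrow> h \<preceq> c *s g"
proof -
  have "\<exists>m. axis i 1 \<preceq> m *s g \<and> (\<forall>c. axis i 1 \<preceq> c *s g \<longrightarrow> m \<le> c)" for i
  proof -
    have "continuous_on UNIV (\<lambda>c. c *s g)"
      unfolding vector_scalar_mult_def
      by (intro continuous_on_vec_lambda continuous_intros)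
    then have "closed {c. axis i 1 \<preceq> c *s g}"
      by (intro closed_below continuous_intros)
    \<comment> \<open>The inverse of \<open>g $ i\<close> is an admissible scalar, so the minimum is
      over a nonempty set.\<close>
    moreover obtain b where "g $ i * b = 1" using assms rmax_inverse by blast
    then have "axis i 1 \<preceq> b *s g"
      by (intro below_if_le) (simp add: axis_def rmax_zero_le mult.commute)
    then have "{c. axis i 1 \<preceq> c *s g} \<noteq> {}" by blast
    ultimately obtain m where "m \<in> {c. axis i 1 \<preceq> c *s g}"
      and "\<And>c. c \<in> {c. axis i 1 \<preceq> c *s g} \<Longrightarrow> m \<le> c"
      by (rule rmax_closed_has_least) blast
    then show ?thesis by auto
  qed
  then obtain X where X: "\<And>i. axis i 1 \<preceq> X i *s g"
    and X_le: "\<And>i c. axis i 1 \<preceq> c *s g \<Longrightarrow> X i \<le> c"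
    by metis
  have "(\<Sum>i\<in>UNIV. h $ i * X i) \<le> c \<longleftrightarrow> h \<preceq> c *s g" for h c
  proof
    assume *: "(\<Sum>i\<in>UNIV. h $ i * X i) \<le> c"
    have "h $ i *s axis i 1 \<preceq> c *s g" for i
    proof -
      have "h $ i *s axis i 1 \<preceq> h $ i *s (X i *s g)" using X by (rule below_scale)
      moreover have "h $ i * X i \<le> c" using * by (simp add: rmax_sum_le_iff)
      then have "h $ i *s (X i *s g) \<preceq> c *s g"
        by (intro below_if_le)
          (simp add: vector_smult_assoc mult.commute[of _ "g $ _"] rmax_mult_left_mono)
      ultimately show ?thesis by (rule below_trans)
    qed
    then have "(\<Sum>i\<in>UNIV. h $ i *s axis i 1) \<preceq> c *s g" by (intro below_sum) auto
    moreover have "(\<Sum>i\<in>UNIV. h $ i *s axis i 1) = h"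
      by (simp add: vec_eq_iff axis_def if_distrib cong: if_cong)
    ultimately show "h \<preceq> c *s g" by simp
  next
    assume *: "h \<preceq> c *s g"
    have "h $ i * X i \<le> c" for i
    proof (cases "h $ i = 0")
      case True
      then show ?thesis by (simp add: rmax_zero_le)
    next
      case False
      \<comment> \<open>Dividing by \<open>h $ i\<close> makes \<open>b * c\<close> admissible for
        the unit vector, so \<open>X i \<le> b * c\<close> by minimality.\<close>
      then obtain b where b: "h $ i * b = 1" by (rule rmax_inverse)
      have "axis i 1 \<preceq> b *s h"
        using b by (intro below_if_le) (simp add: axis_def rmax_zero_le mult.commute)
      moreover have "b *s h \<preceq> b *s (c *s g)" using * by (rule below_scale)
      ultimately have "axis i 1 \<preceq> (b * c) *s g"
        by (metis below_trans vector_smult_assoc)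
      then have "h $ i * X i \<le> h $ i * (b * c)" using X_le rmax_mult_left_mono by blast
      then show ?thesis using b by (metis mult.assoc mult_1)
    qed
    then show "(\<Sum>i\<in>UNIV. h $ i * X i) \<le> c" by (simp add: rmax_sum_le_iff)
  qed
  then show thesis by (intro that[of "\<chi> i. X i"]) simp
qed

text \<open>The orthogonal in the other direction: the largest set whose
  \<open>maxplus_orthogonal\<close> contains \<open>W\<close>.\<close>

definition dual_cone :: "(rmax ^ 'n) set" where
  "dual_cone = {x. \<forall>u v. (u, v) \<in> W \<longrightarrow> (\<Sum>i\<in>UNIV. u $ i * x $ i) = (\<Sum>i\<in>UNIV. v $ i * x $ i)}"

lemma maxplus_cone_dual_cone: "maxplus_cone (*s) dual_cone"
proof -
  have "(\<Sum>i\<in>UNIV. u $ i * (a *s x + b *s y) $ i) =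
    a * (\<Sum>i\<in>UNIV. u $ i * x $ i) + b * (\<Sum>i\<in>UNIV. u $ i * y $ i)" for u x y :: "rmax ^ 'n" and a b
    using rmax_form_linear[of a x b y u] by (simp add: mult.commute)
  then show ?thesis
    unfolding maxplus_cone_def dual_cone_def
    by (simp del: vector_add_component vector_smult_component)
qed

lemma separation:
  assumes "\<not> f \<preceq> g"
  obtains x where "x \<in> dual_cone" "(\<Sum>i\<in>UNIV. f $ i * x $ i) \<noteq> (\<Sum>i\<in>UNIV. g $ i * x $ i)"
proof -
  \<comment> \<open>For \<open>c \<noteq> 0\<close> all entries of \<open>G c\<close> are nonzero,
    as \<open>ex_gauge\<close> requires. Such a \<open>c\<close> with \<open>f \<preceq> G c\<close>
    still false exists because the relation fails on an open set containing
    \<open>0\<close>.\<close>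
  define G where "G c = g + (\<chi> i. c)" for c
  have "continuous_on UNIV G"
    unfolding G_def plus_vec_def
    by (intro continuous_on_vec_lambda continuous_intros)
  then have "closed {c. f \<preceq> G c}" by (intro closed_below continuous_intros)
  then have "open (- {c. f \<preceq> G c})" by (rule open_Compl)
  moreover have "G 0 = g" by (simp add: G_def vec_eq_iff)
  ultimately obtain c where c: "\<not> f \<preceq> G c" "c \<noteq> 0"
    using assms by (auto intro: rmax_nhd_zero_nonzero[of "- {c. f \<preceq> G c}"])
  have "G c $ i \<noteq> 0" for i
  proof -
    have "c \<le> G c $ i" by (simp add: G_def rmax_plus_eq_max)
    then show ?thesis using c(2) rmax_zero_le[of c] by auto
  qed
  then obtain x where x: "\<And>h a. (\<Sum>i\<in>UNIV. h $ i * x $ i) \<le> a \<longleftrightarrow> h \<preceq> a *s G c"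
    by (rule ex_gauge) blast
  \<comment> \<open>With \<open>a\<close> the value of the form at \<open>v\<close>, we get
    \<open>v \<preceq> a *s G c\<close>, and transitivity carries this to \<open>u\<close>.\<close>
  have mono: "(\<Sum>i\<in>UNIV. u $ i * x $ i) \<le> (\<Sum>i\<in>UNIV. v $ i * x $ i)" if "u \<preceq> v" for u v
    using x that below_trans by blast
  have "x \<in> dual_cone"
    unfolding dual_cone_def by (auto intro: antisym mono below_if_mem sym)
  \<comment> \<open>Level \<open>1\<close> of the gauge separates the two values, because
    \<open>1 *s G c = G c\<close>.\<close>
  moreover have "g \<preceq> G c" by (intro below_if_le) (simp add: G_def rmax_plus_eq_max)
  then have "(\<Sum>i\<in>UNIV. g $ i * x $ i) \<le> 1" by (simp add: x)
  moreover have "\<not> (\<Sum>i\<in>UNIV. f $ i * x $ i) \<le> 1" using c(1) by (simp add: x)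
  ultimately show thesis using that by metis
qed

text \<open>One inclusion holds by construction. For the other, \<open>separation\<close> in both
  orders gives \<open>f \<preceq> g\<close> and \<open>g \<preceq> f\<close>, which together mean
  congruence.\<close>

lemma eq_maxplus_orthogonal_dual_cone: "W = maxplus_orthogonal dual_cone"
proof (intro equalityI subrelI)
  show "(f, g) \<in> maxplus_orthogonal dual_cone" if "(f, g) \<in> W" for f g
    using that by (auto simp: maxplus_orthogonal_iff dual_cone_def)
next
  fix f g
  assume *: "(f, g) \<in> maxplus_orthogonal dual_cone"
  have "f \<preceq> g" using separation[of f g] * unfolding maxplus_orthogonal_iff by metis
  moreover have "g \<preceq> f" using separation[of g f] * unfolding maxplus_orthogonal_iff by metis
  ultimately show "(f, g) \<in> W" by (rule below_antisym)
qed

end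

theorem theorem2:
  fixes W :: "((rmax ^ 'n) \<times> (rmax ^ 'n)) set"
  shows "(\<exists>V :: (rmax ^ 'n) set. maxplus_cone (*s) V \<and> W = maxplus_orthogonal V) \<longleftrightarrow>
    (closed W \<and> maxplus_cone pair_scale W) \<and>
    (\<forall>f. (f, f) \<in> W) \<and>
    (\<forall>f g. (f, g) \<in> W \<longrightarrow> (g, f) \<in> W) \<and>
    (\<forall>f g h. (f, g) \<in> W \<and> (g, h) \<in> W \<longrightarrow> (f, h) \<in> W)"
  (is "?lhs \<longleftrightarrow> ?rhs")
proof
  assume ?lhs
  then obtain V where "W = maxplus_orthogonal V" by blast
  then show ?rhs
    by (auto simp: closed_maxplus_orthogonal maxplus_cone_maxplus_orthogonal
        maxplus_orthogonal_iff)
next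
  assume ?rhs
  then interpret closed_congruence W by unfold_locales blast+
  show ?lhs using maxplus_cone_dual_cone eq_maxplus_orthogonal_dual_cone by blast
qed

end
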